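(* Let $\Gamma$ be a non-torsion group and let $a\in\Gamma$ be an element of infinite order. Let $S\subset\Gamma$ be a finite symmetric generating set with $a\in S$, let $G=\mathrm{Cay}(\Gamma,S)$ be the associated Cayley graph, and let $E$ be its set of edges. Then there exists a random spanning sub-forest $\sigma$ of $G$ such that 1. $\sigma$-almost surely, $L(a)$ is contained in the sub-forest; 2. $\sigma$ is a factor of i.i.d. process; 3. $\deg(\sigma)\ge 2\cdot\mathrm{cost}(\Gamma\curvearrowright[0,1]^E)$.
   Context: A group is non-torsion if it contains an element of infinite order (a "non-torsion element"). $S$ symmetric means $S=S^{-1}$, and $S$ does not contain the identity. The Cayley graph $G=\mathrm{Cay}(\Gamma,S)$ has vertex set $\Gamma$ and for every $g\in\Gamma$, $s\in S$ an oriented edge from $g$ to $sg$, whose opposite is the oriented edge from $sg$ to $g$ given by $s^{-1}$; $E$ is the set of unoriented edges $\{g,sg\}$. The group $\Gamma$ acts on $G$ by automorphisms via right multiplication on the vertices, hence acts on $E$, on $\{0,1\}^E$ and on $[0,1]^E$. $L(a)$ is the subgraph of $G$ formed by the union of all bi-infinite lines $\{a^ng\mid n\in\mathbb Z\}$, $g\in\Gamma$, i.e. the spanning subgraph whose edges are all $\{g,ag\}$, $g\in\Gamma$. An element $x\in\{0,1\}^E$ is identified with a spanning subgraph $G(x)\subseteq G$. A forest is a subgraph without simple cycles. A random spanning sub-forest of $G$ is a probability measure $\sigma$ on $\{0,1\}^E$ which is supported on the set of spanning forests. It is a factor of i.i.d. process if there is a measurable $\Gamma$-equivariant map $\Phi:[0,1]^E\to\{0,1\}^E$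 with $\sigma=\Phi_*(\mu^{\otimes E})$, where $\mu$ is Lebesgue measure on $[0,1]$ (in particular $\sigma$ is then $\Gamma$-invariant). For a $\Gamma$-invariant $\sigma$, $\deg(\sigma)$ is the expected degree, with respect to $\sigma$, of the identity vertex $e\in\Gamma$ in the random sub-forest. Cost (Gaboriau). Let $\Gamma\curvearrowright(X,\nu)$ be a probability-measure-preserving essentially free action of a countable group on a standard probability space, with orbit equivalence relation $\mathcal R$. A graphing of $\mathcal R$ is a countable family of Borel isomorphisms $\varphi_i:A_i\to B_i$ between Borel subsets of $X$ with $(x,\varphi_i(x))\in\mathcal R$ for almost all $x\in A_i$, such that up to a null set $\mathcal R$ is the smallest equivalence relation containing all pairs $(x,\varphi_i(x))$. Its cost is $\sum_i\nu(A_i)$, and $\mathrm{cost}(\Gamma\curvearrowright X)$ is the infimum of the costs of all graphings of $\mathcal R$. Here $[0,1]^E$ carries the product measure $\mu^{\otimes E}$. *)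

theory Defs
  imports "HOL-Probability.Probability" "HOL-Algebra.Generated_Groups"
begin

definition cayley_edges :: "('g, 'm) monoid_scheme \<Rightarrow> 'g set \<Rightarrow> 'g set set" where
  "cayley_edges \<Gamma> S = {{g, s \<otimes>\<^bsub>\<Gamma>\<^esub> g} | g s. g \<in> carrier \<Gamma> \<and> s \<in> S}"

definition line_edges :: "('g, 'm) monoid_scheme \<Rightarrow> 'g \<Rightarrow> 'g set set" where
  "line_edges \<Gamma> a = {{g, a \<otimes>\<^bsub>\<Gamma>\<^esub> g} | g. g \<in> carrier \<Gamma>}"

(* {0,1}^E and [0,1]^E. The points of a product measure PiM E _ are the functions on E extended
   by undefined outside E; {0,1} is rendered as bool. *)

definition config_space :: "('g, 'm) monoid_scheme \<Rightarrow> 'g set \<Rightarrow> ('g set \<Rightarrow> bool) measure" where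
  "config_space \<Gamma> S = PiM (cayley_edges \<Gamma> S) (\<lambda>_. count_space UNIV)"

definition iid_space :: "('g, 'm) monoid_scheme \<Rightarrow> 'g set \<Rightarrow> ('g set \<Rightarrow> real) measure" where
  "iid_space \<Gamma> S = PiM (cayley_edges \<Gamma> S) (\<lambda>_. restrict_space lborel {0..1})"

(* The element \<gamma> sends the vertex v to v \<gamma>^-1, which makes right multiplication a left action.
   On labellings this is (\<gamma> x)(e) = x(\<gamma>^-1 e), where \<gamma>^-1 e is the right translate e \<gamma>. *)

definition translate ::
    "('g, 'm) monoid_scheme \<Rightarrow> 'g set \<Rightarrow> 'g \<Rightarrow> ('g set \<Rightarrow> 'c) \<Rightarrow> ('g set \<Rightarrow> 'c)" where
  "translate \<Gamma> S \<gamma> x = (\<lambda>e\<in>cayley_edges \<Gamma> S. x (e #>\<^bsub>\<Gamma>\<^esub> \<gamma>))"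

definition subgraph_edges ::
    "('g, 'm) monoid_scheme \<Rightarrow> 'g set \<Rightarrow> ('g set \<Rightarrow> bool) \<Rightarrow> 'g set set" where
  "subgraph_edges \<Gamma> S x = {e \<in> cayley_edges \<Gamma> S. x e}"

definition simple_cycle :: "'v set set \<Rightarrow> 'v list \<Rightarrow> bool" where
  "simple_cycle F vs \<longleftrightarrow> length vs \<ge> 3 \<and> distinct vs \<and>
     (\<forall>i<length vs. {vs ! i, vs ! (Suc i mod length vs)} \<in> F)"

definition forest :: "'v set set \<Rightarrow> bool" where
  "forest F \<longleftrightarrow> (\<nexists>vs. simple_cycle F vs)"

definition random_spanning_forest ::
    "('g, 'm) monoid_scheme \<Rightarrow> 'g set \<Rightarrow> ('g set \<Rightarrow> bool) measure \<Rightarrow> bool" where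
  "random_spanning_forest \<Gamma> S \<sigma> \<longleftrightarrow>
     prob_space \<sigma> \<and> sets \<sigma> = sets (config_space \<Gamma> S) \<and>
     (AE x in \<sigma>. forest (subgraph_edges \<Gamma> S x))"

definition factor_of_iid ::
    "('g, 'm) monoid_scheme \<Rightarrow> 'g set \<Rightarrow> ('g set \<Rightarrow> bool) measure \<Rightarrow> bool" where
  "factor_of_iid \<Gamma> S \<sigma> \<longleftrightarrow>
     (\<exists>\<Phi> \<in> iid_space \<Gamma> S \<rightarrow>\<^sub>M config_space \<Gamma> S.
        (\<forall>\<gamma>\<in>carrier \<Gamma>. \<forall>x\<in>space (iid_space \<Gamma> S).
           \<Phi> (translate \<Gamma> S \<gamma> x) = translate \<Gamma> S \<gamma> (\<Phi> x)) \<and>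
        \<sigma> = distr (iid_space \<Gamma> S) (config_space \<Gamma> S) \<Phi>)"

(* Edges are two-element sets when the identity is not in S, so the degree of a vertex is the
   number of edges containing it. *)

definition expected_degree ::
    "('g, 'm) monoid_scheme \<Rightarrow> 'g set \<Rightarrow> ('g set \<Rightarrow> bool) measure \<Rightarrow> ennreal" where
  "expected_degree \<Gamma> S \<sigma> =
     (\<integral>\<^sup>+ x. of_nat (card {e \<in> subgraph_edges \<Gamma> S x. \<one>\<^bsub>\<Gamma>\<^esub> \<in> e}) \<partial>\<sigma>)"

definition orbit_relation ::
    "('g, 'm) monoid_scheme \<Rightarrow> 'x measure \<Rightarrow> ('g \<Rightarrow> 'x \<Rightarrow> 'x) \<Rightarrow> 'x rel" where
  "orbit_relation \<Gamma> M act = {(x, act \<gamma> x) | \<gamma> x. \<gamma> \<in> carrier \<Gamma> \<and> x \<in> space M}"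

definition borel_isomorphism ::
    "'x measure \<Rightarrow> 'x set \<Rightarrow> 'x set \<Rightarrow> ('x \<Rightarrow> 'x) \<Rightarrow> bool" where
  "borel_isomorphism M A B f \<longleftrightarrow>
     A \<in> sets M \<and> B \<in> sets M \<and> bij_betw f A B \<and>
     f \<in> restrict_space M A \<rightarrow>\<^sub>M restrict_space M B \<and>
     the_inv_into A f \<in> restrict_space M B \<rightarrow>\<^sub>M restrict_space M A"

definition generated_equiv :: "'x set \<Rightarrow> 'x rel \<Rightarrow> 'x rel" where
  "generated_equiv X P = \<Inter>{Q. equiv X Q \<and> P \<subseteq> Q}"

(* Countable families are indexed by subsets of nat. The last conjunct says that R and the
   generated relation have the same class at almost every point. *)

definition graphing ::
    "'x measure \<Rightarrow> 'x rel \<Rightarrow> nat set \<Rightarrow> (nat \<Rightarrow> 'x set) \<Rightarrow> (nat \<Rightarrow> 'x set)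
       \<Rightarrow> (nat \<Rightarrow> 'x \<Rightarrow> 'x) \<Rightarrow> bool" where
  "graphing M R I A B \<phi> \<longleftrightarrow>
     (\<forall>i\<in>I. borel_isomorphism M (A i) (B i) (\<phi> i)) \<and>
     (\<forall>i\<in>I. AE x in M. x \<in> A i \<longrightarrow> (x, \<phi> i x) \<in> R) \<and>
     (AE x in M. R `` {x} =
        generated_equiv (space M) {(y, \<phi> i y) | i y. i \<in> I \<and> y \<in> A i} `` {x})"

definition cost :: "'x measure \<Rightarrow> 'x rel \<Rightarrow> ennreal" where
  "cost M R = Inf {\<Sum>\<^sub>\<infinity>i\<in>I. emeasure M (A i) | I A B \<phi>. graphing M R I A B \<phi>}"

definition action_cost ::
    "('g, 'm) monoid_scheme \<Rightarrow> 'x measure \<Rightarrow> ('g \<Rightarrow> 'x \<Rightarrow> 'x) \<Rightarrow> ennreal" where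
  "action_cost \<Gamma> M act = cost M (orbit_relation \<Gamma> M act)"

end

theory Submission
  imports Defs
begin

text \<open>
  Delete an edge outside the lines \<open>L\<close> when its endpoints can be joined through \<open>L\<close> and edges
  with strictly smaller labels. Almost surely the labels are distinct; then no cycle survives, since
  the largest label outside \<open>L\<close> on it would have been deleted. If the labels are first rounded
  down to multiples of \<open>1/k\<close>, fewer edges are deleted, and induction on the rounded label shows
  that the remaining graph is still connected. So it yields a graphing, and its cost is half the
  expected degree. As \<open>k\<close> grows the rounded graphs converge pointwise to the forest, whose
  expected degree is therefore at least twice the cost.
\<close>

section \<open>Connectivity through edge sets, and simple cycles\<close>

definition adj :: "'v set set \<Rightarrow> 'v rel" where
  "adj D = {(u, v). {u, v} \<in> D}"

text \<open>Edges are unordered sets, so connectedness of their endpoints is phrased for all pairs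
  of elements of \<open>e\<close>, without choosing an orientation.\<close>

definition linked :: "'v set set \<Rightarrow> 'v set \<Rightarrow> bool" where
  "linked D e \<longleftrightarrow> (\<forall>u\<in>e. \<forall>v\<in>e. (u, v) \<in> (adj D)\<^sup>*)"

lemma sym_adj: "sym (adj D)"
  by (auto simp: adj_def sym_def insert_commute)

lemma linked_doubleton:
  assumes "(u, v) \<in> (adj D)\<^sup>*"
  shows "linked D {u, v}"
  using assms symD[OF sym_rtrancl[OF sym_adj]] by (fastforce simp: linked_def)

lemma linked_mono:
  assumes "linked D e" "D \<subseteq> D'"
  shows "linked D' e"
proof -
  have "adj D \<subseteq> adj D'" using assms(2) by (auto simp: adj_def)
  then have "(adj D)\<^sup>* \<subseteq> (adj D')\<^sup>*" by (rule rtrancl_mono)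
  with assms(1) show ?thesis by (auto simp: linked_def)
qed

text \<open>Walking round the cycle the long way, from the far end of edge \<open>i\<close> back to
  its near end, passes through all edges except the one at position \<open>i\<close>.\<close>

lemma simple_cycle_linked:
  assumes cyc: "simple_cycle F vs" and i: "i < length vs"
    and e: "e = {vs ! i, vs ! (Suc i mod length vs)}"
  shows "linked ((\<lambda>j. {vs ! j, vs ! (Suc j mod length vs)}) ` ({..<length vs} - {i})) e"
    (is "linked ?D e")
proof -
  let ?n = "length vs"
  have n: "?n \<ge> 3" using cyc by (simp add: simple_cycle_def)
  then have n0: "0 < ?n" by linarith
  have path: "(vs ! (Suc i mod ?n), vs ! ((Suc i + j) mod ?n)) \<in> (adj ?D)\<^sup>*" if "j < ?n" for j
    using that
  proof (induction j)
    case 0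
    then show ?case by simp
  next
    case (Suc j)
    define m where "m = (Suc i + j) mod ?n"
    \<comment> \<open>The walk starts at position \<open>Suc i\<close>, so it returns to position
      \<open>i\<close> only after \<open>length vs - 1\<close> steps, and \<open>j\<close> is still
      smaller than that.\<close>
    have "m \<noteq> i"
    proof
      assume "m = i"
      then have "(Suc i + j) mod ?n = i mod ?n" using i by (simp add: m_def)
      then have "?n dvd Suc i + j - i" by (subst (asm) mod_eq_dvd_iff_nat) auto
      then have "?n dvd Suc j" by simp
      with Suc.prems show False by (auto dest: dvd_imp_le)
    qed
    moreover have "m < ?n" using n0 by (simp add: m_def)
    moreover have "Suc m mod ?n = (Suc i + Suc j) mod ?n"
      by (simp add: m_def mod_Suc_eq)
    ultimately have "(vs ! m, vs ! ((Suc i + Suc j) mod ?n)) \<in> adj ?D"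
      by (force simp: adj_def)
    with Suc show ?case unfolding m_def
      by (meson Suc_lessD rtrancl.rtrancl_into_rtrancl)
  qed
  have "Suc i + (?n - 1) = i + ?n" using n by simp
  then have "(Suc i + (?n - 1)) mod ?n = i" using i by simp
  moreover have "(vs ! (Suc i mod ?n), vs ! ((Suc i + (?n - 1)) mod ?n)) \<in> (adj ?D)\<^sup>*"
    by (rule path) (use n0 in simp)
  ultimately have "(vs ! (Suc i mod ?n), vs ! i) \<in> (adj ?D)\<^sup>*" by metis
  then have "(vs ! i, vs ! (Suc i mod ?n)) \<in> (adj ?D)\<^sup>*"
    by (rule symD[OF sym_rtrancl[OF sym_adj]])
  then show ?thesis unfolding e by (rule linked_doubleton)
qed

text \<open>If two positions carried the same edge, each would be the cyclic successor of the other,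
  which forces length 2.\<close>

lemma simple_cycle_edges_inj:
  assumes "simple_cycle F vs"
  shows "inj_on (\<lambda>j. {vs ! j, vs ! (Suc j mod length vs)}) {..<length vs}"
proof (rule inj_onI)
  fix i j
  let ?n = "length vs"
  assume ij: "i \<in> {..<?n}" "j \<in> {..<?n}"
    and eq: "{vs ! i, vs ! (Suc i mod ?n)} = {vs ! j, vs ! (Suc j mod ?n)}"
  have n: "?n \<ge> 3" and d: "distinct vs" using assms by (auto simp: simple_cycle_def)
  show "i = j"
  proof (rule ccontr)
    assume "i \<noteq> j"
    have lt: "Suc i mod ?n < ?n" "Suc j mod ?n < ?n" using n by (auto intro!: mod_less_divisor)
    from eq \<open>i \<noteq> j\<close> have "vs ! i = vs ! (Suc j mod ?n)" "vs ! j = vs ! (Suc i mod ?n)"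
      using ij d by (auto simp: doubleton_eq_iff nth_eq_iff_index_eq)
    then have "i = Suc j mod ?n" "j = Suc i mod ?n"
      using ij d lt by (auto simp: nth_eq_iff_index_eq)
    moreover have "i mod ?n = i" "j mod ?n = j" using ij by auto
    ultimately show False using n by (auto simp: mod_Suc split: if_splits)
  qed
qed

text \<open>Each element is the product of a finite word in the generators and their inverses, and
  there are countably many such words.\<close>

lemma (in group) countable_generate:
  assumes S: "S \<subseteq> carrier G" "countable S"
  shows "countable (generate G S)"
proof -
  let ?T = "S \<union> m_inv G ` S"
  define p where "p = (\<lambda>xs. foldr (\<otimes>) xs \<one>)"
  have closed: "p xs \<in> carrier G" if "xs \<in> lists ?T" for xs
    using that S by (induction xs) (auto simp: p_def)
  have app: "p (xs @ ys) = p xs \<otimes> p ys" if "xs \<in> lists ?T" "ys \<in> lists ?T" for xs ys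
    using that
  proof (induction xs)
    case Nil
    then show ?case using closed[of ys] by (simp add: p_def)
  next
    case (Cons x xs)
    then have "x \<in> carrier G" using S by auto
    moreover from Cons have "p xs \<in> carrier G" "p ys \<in> carrier G" using closed by auto
    ultimately have "x \<otimes> (p xs \<otimes> p ys) = x \<otimes> p xs \<otimes> p ys" by (simp add: m_assoc)
    with Cons show ?case by (simp add: p_def)
  qed
  have "x \<in> p ` lists ?T" if "x \<in> generate G S" for x
    using that
  proof (induction x rule: generate.induct)
    case one
    show ?case by (rule image_eqI[of _ _ "[]"]) (auto simp: p_def)
  next
    case (incl h)
    then show ?case using S by (intro image_eqI[of _ _ "[h]"]) (auto simp: p_def)
  next
    case (inv h)
    then show ?case using S by (intro image_eqI[of _ _ "[inv h]"]) (auto simp: p_def)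
  next
    case (eng h1 h2)
    then obtain xs ys where "xs \<in> lists ?T" "ys \<in> lists ?T" "h1 = p xs" "h2 = p ys" by auto
    then show ?case using app by (intro image_eqI[of _ _ "xs @ ys"]) auto
  qed
  moreover have "countable (p ` lists ?T)"
    using S by (intro countable_image countable_lists) auto
  ultimately show ?thesis by (meson countable_subset subsetI)
qed

text \<open>A cycle has finitely many edges. Over a countable edge set this turns being a forest
  into a countable condition, hence a measurable one.\<close>

lemma forest_iff_finite: "forest F \<longleftrightarrow> (\<forall>C. finite C \<and> C \<subseteq> F \<longrightarrow> forest C)"
proof
  assume "forest F"
  then show "\<forall>C. finite C \<and> C \<subseteq> F \<longrightarrow> forest C"
    unfolding forest_def simple_cycle_def by blast
next
  assume fin: "\<forall>C. finite C \<and> C \<subseteq> F \<longrightarrow> forest C"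
  show "forest F"
    unfolding forest_def
  proof
    assume "\<exists>vs. simple_cycle F vs"
    then obtain vs where vs: "simple_cycle F vs" ..
    define C where "C = (\<lambda>i. {vs ! i, vs ! (Suc i mod length vs)}) ` {..<length vs}"
    have "finite C" "C \<subseteq> F" "simple_cycle C vs"
      using vs by (auto simp: simple_cycle_def C_def)
    with fin show False by (auto simp: forest_def)
  qed
qed

section \<open>The Cayley graph, its lines and the right translations\<close>

locale cayley_line = group \<Gamma> for \<Gamma> :: "('g, 'm) monoid_scheme" (structure) +
  fixes S :: "'g set" and a :: 'g
  assumes S_carrier: "S \<subseteq> carrier \<Gamma>" and fin_S: "finite S"
    and S_sym: "m_inv \<Gamma> ` S = S" and one_notin: "\<one> \<notin> S"
    and gen: "generate \<Gamma> S = carrier \<Gamma>"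
    and a_S: "a \<in> S"
    and a_inf: "\<And>n::nat. n > 0 \<Longrightarrow> a [^] n \<noteq> \<one>"
begin

abbreviation "E \<equiv> cayley_edges \<Gamma> S"
abbreviation "L \<equiv> line_edges \<Gamma> a"
abbreviation "M \<equiv> iid_space \<Gamma> S"
abbreviation "T \<equiv> translate \<Gamma> S"

lemma a_carrier: "a \<in> carrier \<Gamma>"
  using S_carrier a_S by auto

lemma inv_S: "s \<in> S \<Longrightarrow> inv s \<in> S"
  using S_sym by blast

lemma edgeI: "s \<in> S \<Longrightarrow> g \<in> carrier \<Gamma> \<Longrightarrow> {g, s \<otimes> g} \<in> E"
  by (auto simp: cayley_edges_def)

lemma line_edge_in: "g \<in> carrier \<Gamma> \<Longrightarrow> {g, a \<otimes> g} \<in> E"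
  using edgeI a_S by blast

lemma line_subset: "L \<subseteq> E"
  using a_S by (auto simp: cayley_edges_def line_edges_def)

lemma edge_subset: "e \<in> E \<Longrightarrow> e \<subseteq> carrier \<Gamma>"
  using S_carrier by (auto simp: cayley_edges_def)

lemma mult_S_neq: "s \<in> S \<Longrightarrow> g \<in> carrier \<Gamma> \<Longrightarrow> s \<otimes> g \<noteq> g"
  using one_notin S_carrier by (metis r_cancel_one subsetD)

text \<open>Either endpoint can serve as base point: if the edge was presented from the other end,
  \<open>s\<close> is replaced by its inverse.\<close>

lemma edge_cases:
  assumes "{u, v} \<in> E"
  obtains s where "s \<in> S" "u \<in> carrier \<Gamma>" "v = s \<otimes> u" "u \<noteq> v"
proof -
  from assms obtain g s where g: "g \<in> carrier \<Gamma>" "s \<in> S" "{u, v} = {g, s \<otimes> g}"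
    by (auto simp: cayley_edges_def)
  then consider "u = g" "v = s \<otimes> g" | "v = g" "u = s \<otimes> g" by (auto simp: doubleton_eq_iff)
  then show ?thesis
  proof cases
    case 1
    then show ?thesis using that g mult_S_neq by metis
  next
    case 2
    then have "v = inv s \<otimes> u" using g S_carrier by (auto simp: m_assoc[symmetric] subset_iff)
    moreover have "u \<in> carrier \<Gamma>" using g 2 S_carrier by auto
    ultimately show ?thesis using that[of "inv s"] inv_S g 2 mult_S_neq by metis
  qed
qed

lemma countable_edges: "countable E"
proof -
  have "countable (carrier \<Gamma>)"
    using countable_generate[OF S_carrier] gen fin_S by (simp add: countable_finite)
  moreover have "E = (\<lambda>(g, s). {g, s \<otimes> g}) ` (carrier \<Gamma> \<times> S)"
    by (auto simp: cayley_edges_def)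
  ultimately show ?thesis using fin_S by (simp add: countable_finite)
qed

text \<open>Edges come from left multiplication and shifts from right multiplication, so the two
  commute. This is why translations preserve both \<open>E\<close> and \<open>L\<close>.\<close>

lemma shift_edge: "g \<in> carrier \<Gamma> \<Longrightarrow> h \<in> carrier \<Gamma> \<Longrightarrow> b \<in> carrier \<Gamma> \<Longrightarrow>
    {g, b \<otimes> g} #> h = {g \<otimes> h, b \<otimes> (g \<otimes> h)}"
  by (auto simp: r_coset_def m_assoc)

lemma shift_shift: "e \<subseteq> carrier \<Gamma> \<Longrightarrow> g \<in> carrier \<Gamma> \<Longrightarrow> h \<in> carrier \<Gamma> \<Longrightarrow>
    e #> g #> h = e #> (g \<otimes> h)"
  by (rule coset_mult_assoc)

lemma shift_in_edges:
  assumes "e \<in> E" "\<gamma> \<in> carrier \<Gamma>"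
  shows "e #> \<gamma> \<in> E"
proof -
  from assms obtain g s where "e = {g, s \<otimes> g}" "g \<in> carrier \<Gamma>" "s \<in> S"
    by (auto simp: cayley_edges_def)
  then show ?thesis using assms edgeI[of s "g \<otimes> \<gamma>"] S_carrier by (auto simp: shift_edge)
qed

lemma shift_in_line:
  assumes "e \<in> L" "\<gamma> \<in> carrier \<Gamma>"
  shows "e #> \<gamma> \<in> L"
proof -
  from assms obtain g where "e = {g, a \<otimes> g}" "g \<in> carrier \<Gamma>"
    by (auto simp: line_edges_def)
  then have "e #> \<gamma> = {g \<otimes> \<gamma>, a \<otimes> (g \<otimes> \<gamma>)}" "g \<otimes> \<gamma> \<in> carrier \<Gamma>"
    using assms a_carrier by (auto simp: shift_edge)
  then show ?thesis by (auto simp: line_edges_def)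
qed

lemma shift_inv [simp]:
  "e \<in> E \<Longrightarrow> \<gamma> \<in> carrier \<Gamma> \<Longrightarrow> e #> \<gamma> #> inv \<gamma> = e"
  "e \<in> E \<Longrightarrow> \<gamma> \<in> carrier \<Gamma> \<Longrightarrow> e #> inv \<gamma> #> \<gamma> = e"
  using edge_subset by (auto simp: shift_shift)

lemma shift_in_line_iff: "e \<in> E \<Longrightarrow> \<gamma> \<in> carrier \<Gamma> \<Longrightarrow> e #> \<gamma> \<in> L \<longleftrightarrow> e \<in> L"
  using shift_in_line[of e \<gamma>] shift_in_line[of "e #> \<gamma>" "inv \<gamma>"] by auto

lemma inj_shift: "\<gamma> \<in> carrier \<Gamma> \<Longrightarrow> inj_on (\<lambda>e. e #> \<gamma>) E"
  by (rule inj_on_inverseI[where g = "\<lambda>e. e #> inv \<gamma>"]) simp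

lemma translate_apply: "e \<in> E \<Longrightarrow> T \<gamma> x e = x (e #> \<gamma>)"
  by (simp add: translate_def)

lemma translate_mult:
  assumes "g \<in> carrier \<Gamma>" "h \<in> carrier \<Gamma>"
  shows "T g (T h x) = T (g \<otimes> h) x"
  using assms by (auto simp: translate_def fun_eq_iff shift_in_edges shift_shift edge_subset)

lemma translate_one: "x \<in> extensional E \<Longrightarrow> T \<one> x = x"
  using edge_subset by (auto simp: translate_def fun_eq_iff extensional_def)

text \<open>Every step of a cycle in \<open>L\<close> multiplies by \<open>a\<close> or its inverse.
  As vertices do not repeat, the direction never changes, and closing up would make a positive power
  of \<open>a\<close> trivial.\<close>

lemma line_forest: "forest L"
  unfolding forest_def
proof
  assume "\<exists>vs. simple_cycle L vs"
  then obtain vs where "simple_cycle L vs" ..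
  then have n: "length vs \<ge> 3" and d: "distinct vs"
    and ed: "\<And>i. i < length vs \<Longrightarrow> {vs ! i, vs ! (Suc i mod length vs)} \<in> L"
    by (auto simp: simple_cycle_def)
  let ?n = "length vs"
  \<comment> \<open>Here \<open>b\<close> stands for \<open>a\<close> or its inverse, whichever
    describes the first step, so that both directions are treated at once.\<close>
  have contra: False
    if b: "b \<in> carrier \<Gamma>" and inf: "\<And>n::nat. n > 0 \<Longrightarrow> b [^] n \<noteq> \<one>"
      and Lb: "\<And>u v. {u, v} \<in> L \<Longrightarrow> u \<in> carrier \<Gamma> \<and> v \<in> carrier \<Gamma> \<and> (v = b \<otimes> u \<or> u = b \<otimes> v)"
      and v1: "vs ! 1 = b \<otimes> vs ! 0" for b
  proof -
    have e: "{vs ! i, vs ! Suc i} \<in> L" if "Suc i < ?n" for i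
      using ed[of i] that by simp
    have vc: "vs ! i \<in> carrier \<Gamma>" if "i < ?n" for i
      using Lb[OF ed[OF that]] by auto
    have v0: "vs ! 0 \<in> carrier \<Gamma>" using vc n by force
    have step: "vs ! Suc i = b \<otimes> vs ! i" if "Suc i < ?n" for i
      using that
    proof (induction i)
      case 0
      then show ?case using v1 by simp
    next
      case (Suc i)
      from Lb[OF e[OF Suc.prems]] consider "vs ! Suc (Suc i) = b \<otimes> vs ! Suc i" | "vs ! Suc i = b \<otimes> vs ! Suc (Suc i)"
        by auto
      then show ?case
      proof cases
        \<comment> \<open>Turning back would repeat the vertex visited two steps earlier.\<close>
        case 2
        with Suc have "b \<otimes> vs ! i = b \<otimes> vs ! Suc (Suc i)" by simp
        then have "vs ! i = vs ! Suc (Suc i)" using vc Suc.prems b by simp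
        then show ?thesis using d Suc.prems by (simp add: nth_eq_iff_index_eq)
      qed
    qed
    have pow: "vs ! i = b [^] i \<otimes> vs ! 0" if "i < ?n" for i
      using that
    proof (induction i)
      case 0
      then show ?case using vc by simp
    next
      case (Suc i)
      then have "vs ! Suc i = b \<otimes> (b [^] i \<otimes> vs ! 0)" using step by simp
      also have "\<dots> = b [^] Suc i \<otimes> vs ! 0"
        using b v0 nat_pow_Suc2[OF b, of i] by (subst m_assoc[symmetric]) auto
      finally show ?case .
    qed
    have last: "Suc (?n - 1) = ?n" "?n - 1 < ?n" using n by auto
    have "{vs ! (?n - 1), vs ! 0} \<in> L" using ed[of "?n - 1"] n last by simp
    \<comment> \<open>The closing edge either continues in direction \<open>b\<close>, giving a
      trivial power of \<open>b\<close>, or makes the last vertex equal to the second one.\<close>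
    with Lb consider "vs ! 0 = b \<otimes> vs ! (?n - 1)" | "vs ! (?n - 1) = b \<otimes> vs ! 0" by blast
    then show False
    proof cases
      case 1
      also have "vs ! (?n - 1) = b [^] (?n - 1) \<otimes> vs ! 0"
        using pow n by simp
      also have "b \<otimes> (b [^] (?n - 1) \<otimes> vs ! 0) = b [^] Suc (?n - 1) \<otimes> vs ! 0"
        using b v0 nat_pow_Suc2[OF b, of "?n - 1"] by (subst m_assoc[symmetric]) auto
      finally have "b [^] ?n = \<one>"
        using v0 b unfolding last by (metis nat_pow_closed r_cancel_one')
      then show False using inf[of ?n] n by linarith
    next
      case 2
      then have "vs ! (?n - 1) = vs ! 1" using v1 by simp
      moreover have "?n - 1 < ?n" "1 < ?n" "?n - 1 \<noteq> 1" using n by auto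
      ultimately show False using d nth_eq_iff_index_eq by blast
    qed
  qed
  have La: "u \<in> carrier \<Gamma> \<and> v \<in> carrier \<Gamma> \<and> (v = a \<otimes> u \<or> u = a \<otimes> v)" if "{u, v} \<in> L" for u v
    using that a_carrier by (auto simp: line_edges_def doubleton_eq_iff)
  have "{vs ! 0, vs ! 1} \<in> L" using ed[of 0] n by force
  with La consider "vs ! 1 = a \<otimes> vs ! 0" | "vs ! 0 = a \<otimes> vs ! 1" by blast
  then show False
  proof cases
    case 1
    then show False using contra[OF a_carrier a_inf La] by simp
  next
    case 2
    have "vs ! 1 \<in> carrier \<Gamma>" using La[OF \<open>{vs ! 0, vs ! 1} \<in> L\<close>] by simp
    then have "vs ! 1 = inv a \<otimes> vs ! 0" using 2 a_carrier by (simp add: m_assoc[symmetric])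
    moreover have "inv a [^] n \<noteq> \<one>" if "n > 0" for n :: nat
      using a_inf[OF that] a_carrier by (metis inv_eq_1_iff nat_pow_closed nat_pow_inv)
    moreover have "u \<in> carrier \<Gamma> \<and> v \<in> carrier \<Gamma> \<and> (v = inv a \<otimes> u \<or> u = inv a \<otimes> v)"
      if "{u, v} \<in> L" for u v
      using La[OF that] a_carrier by (auto simp: m_assoc[symmetric])
    ultimately show False using contra[of "inv a"] a_carrier by blast
  qed
qed

section \<open>The deletion rule: equivariance and absence of cycles\<close>

text \<open>
  The label transformation \<open>l\<close> is the identity for the forest and rounding for its connected
  approximations. Asking for a finite set \<open>W\<close> of edges, rather than a path, makes the event a
  countable union of comparisons of labels.
\<close>

definition kept :: "(real \<Rightarrow> real) \<Rightarrow> ('g set \<Rightarrow> real) \<Rightarrow> 'g set \<Rightarrow> bool" where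
  "kept l x e \<longleftrightarrow> e \<in> L \<or>
     \<not> (\<exists>W. finite W \<and> W \<subseteq> E \<and> linked (W \<union> L) e \<and> (\<forall>f\<in>W. l (x f) < l (x e)))"

lemma rtrancl_adj_shift:
  assumes "(u, v) \<in> (adj D)\<^sup>*" "\<And>f. f \<in> D \<Longrightarrow> f #> \<gamma> \<in> D'"
  shows "(u \<otimes> \<gamma>, v \<otimes> \<gamma>) \<in> (adj D')\<^sup>*"
  using assms(1)
proof (induction rule: rtrancl_induct)
  case (step y z)
  have "{y, z} #> \<gamma> = {y \<otimes> \<gamma>, z \<otimes> \<gamma>}" by (auto simp: r_coset_def)
  with step(2) assms(2)[of "{y, z}"] have "(y \<otimes> \<gamma>, z \<otimes> \<gamma>) \<in> adj D'"
    by (auto simp: adj_def)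
  with step.IH show ?case by (rule rtrancl_into_rtrancl)
qed simp

text \<open>A set \<open>W\<close> that deletes the shifted edge is moved back by the inverse of
  \<open>\<gamma>\<close>. Paths and lines move along with it, and the labels compared are the
  same.\<close>

lemma not_kept_translate:
  assumes e: "e \<in> E" and \<gamma>: "\<gamma> \<in> carrier \<Gamma>" and nk: "\<not> kept l x (e #> \<gamma>)"
  shows "\<not> kept l (T \<gamma> x) e"
proof -
  from nk obtain W where W: "finite W" "W \<subseteq> E" "linked (W \<union> L) (e #> \<gamma>)"
    "\<forall>f\<in>W. l (x f) < l (x (e #> \<gamma>))" and nL: "e #> \<gamma> \<notin> L"
    by (auto simp: kept_def)
  let ?W = "(\<lambda>f. f #> inv \<gamma>) ` W"
  have "linked (?W \<union> L) e"
    unfolding linked_def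
  proof (intro ballI)
    fix u v assume uv: "u \<in> e" "v \<in> e"
    then have "u \<otimes> \<gamma> \<in> e #> \<gamma>" "v \<otimes> \<gamma> \<in> e #> \<gamma>" by (auto simp: r_coset_def)
    with W(3) have "(u \<otimes> \<gamma>, v \<otimes> \<gamma>) \<in> (adj (W \<union> L))\<^sup>*" by (auto simp: linked_def)
    then have "(u \<otimes> \<gamma> \<otimes> inv \<gamma>, v \<otimes> \<gamma> \<otimes> inv \<gamma>) \<in> (adj (?W \<union> L))\<^sup>*"
      by (rule rtrancl_adj_shift) (use \<gamma> shift_in_line in auto)
    moreover have "u \<in> carrier \<Gamma>" "v \<in> carrier \<Gamma>" using uv edge_subset[OF e] by auto
    ultimately show "(u, v) \<in> (adj (?W \<union> L))\<^sup>*" using \<gamma> by (simp add: m_assoc)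
  qed
  moreover have "l (T \<gamma> x f) < l (T \<gamma> x e)" if f: "f \<in> ?W" for f
  proof -
    from f obtain f' where f': "f' \<in> W" "f = f' #> inv \<gamma>" by auto
    then have "f \<in> E" "f #> \<gamma> = f'" using W(2) \<gamma> by (auto intro: shift_in_edges)
    then show ?thesis using W(4) f' e by (simp add: translate_apply)
  qed
  moreover have "finite ?W" "?W \<subseteq> E" using W \<gamma> by (auto intro: shift_in_edges)
  moreover have "e \<notin> L" using nL e \<gamma> by (simp add: shift_in_line_iff)
  ultimately show ?thesis unfolding kept_def by blast
qed

text \<open>The missing implication is the previous lemma for the inverse of \<open>\<gamma>\<close>
  and the labelling \<open>T \<gamma> x\<close>; extensionality ensures that translating back
  recovers \<open>x\<close> itself.\<close>

lemma kept_translate: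
  assumes "e \<in> E" "\<gamma> \<in> carrier \<Gamma>" "x \<in> extensional E"
  shows "kept l (T \<gamma> x) e \<longleftrightarrow> kept l x (e #> \<gamma>)"
proof -
  have "T (inv \<gamma>) (T \<gamma> x) = x" using assms by (simp add: translate_mult translate_one)
  then show ?thesis
    using not_kept_translate[of e \<gamma> l x] not_kept_translate[of "e #> \<gamma>" "inv \<gamma>" l "T \<gamma> x"] assms
    by (auto simp: shift_in_edges)
qed

lemma kept_forest:
  assumes inj: "inj_on x E"
  shows "forest {e \<in> E. kept id x e}"
  unfolding forest_def
proof
  assume "\<exists>vs. simple_cycle {e \<in> E. kept id x e} vs"
  then obtain vs where cyc: "simple_cycle {e \<in> E. kept id x e} vs" ..
  define c where "c = (\<lambda>j. {vs ! j, vs ! (Suc j mod length vs)})"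
  have c: "c j \<in> E" "kept id x (c j)" if "j < length vs" for j
    using cyc that by (auto simp: simple_cycle_def c_def)
  have injc: "inj_on c {..<length vs}"
    unfolding c_def by (rule simple_cycle_edges_inj[OF cyc])
  define J where "J = {j. j < length vs \<and> c j \<notin> L}"
  have "J \<noteq> {}"
  proof
    assume "J = {}"
    then have "simple_cycle L vs" using cyc by (auto simp: simple_cycle_def J_def c_def)
    then show False using line_forest by (auto simp: forest_def)
  qed
  moreover have "finite J" by (simp add: J_def)
  ultimately have "Max ((\<lambda>j. x (c j)) ` J) \<in> (\<lambda>j. x (c j)) ` J" by (intro Max_in) auto
  \<comment> \<open>The position \<open>i\<close> carries the largest label among the cycle edges
    outside \<open>L\<close>; the others of these form the deleting set \<open>?W\<close>.\<close>
  then obtain i where i: "i \<in> J" and max_i: "x (c i) = Max ((\<lambda>j. x (c j)) ` J)" by auto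
  have max: "x (c j) \<le> x (c i)" if "j \<in> J" for j
    unfolding max_i using that \<open>finite J\<close> by (intro Max_ge) auto
  let ?W = "c ` (J - {i})"
  have "linked (c ` ({..<length vs} - {i})) (c i)"
    using simple_cycle_linked[OF cyc, of i "c i"] i unfolding c_def by (auto simp: J_def)
  \<comment> \<open>The cycle edges lying on lines are absorbed by \<open>L\<close>, so only edges
    with compared labels remain in \<open>?W\<close>.\<close>
  then have "linked (?W \<union> L) (c i)"
    by (rule linked_mono) (auto simp: J_def)
  moreover have "x f < x (c i)" if f: "f \<in> ?W" for f
  proof -
    from f obtain j where j: "j \<in> J" "j \<noteq> i" "f = c j" by auto
    then have "c j \<noteq> c i" using injc i by (auto simp: inj_on_def J_def)
    then have "x (c j) \<noteq> x (c i)" using inj j i c by (auto simp: inj_on_def J_def)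
    with max[OF j(1)] j show ?thesis by simp
  qed
  moreover have "finite ?W" "?W \<subseteq> E" using c by (auto simp: J_def)
  moreover have "c i \<notin> L" "kept id x (c i)" using i c by (auto simp: J_def)
  ultimately show False unfolding kept_def id_def by blast
qed

section \<open>The i.i.d. labels: measurability, invariance and distinctness\<close>

lemma prob_unit: "prob_space (restrict_space lborel {0..1::real})"
  by (rule prob_space_restrict_space) auto

lemma prob_M: "prob_space M"
  unfolding iid_space_def by (rule prob_space_PiM) (rule prob_unit)

lemma space_M_extensional: "x \<in> space M \<Longrightarrow> x \<in> extensional E"
  by (auto simp: iid_space_def space_PiM PiE_def)

lemma space_M_range: "x \<in> space M \<Longrightarrow> e \<in> E \<Longrightarrow> x e \<in> {0..1}"
  by (auto simp: iid_space_def space_PiM space_restrict_space)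

lemma measurable_label:
  assumes "e \<in> E"
  shows "(\<lambda>x. x e) \<in> borel_measurable M"
proof -
  have "(\<lambda>x. x e) \<in> M \<rightarrow>\<^sub>M restrict_space lborel {0..1}"
    unfolding iid_space_def using assms by (rule measurable_component_singleton)
  then show ?thesis by (simp add: measurable_restrict_space2_iff)
qed

lemma sets_kept:
  assumes l: "l \<in> borel_measurable borel" and e: "e \<in> E"
  shows "{x \<in> space M. kept l x e} \<in> sets M"
proof (cases "e \<in> L")
  case True
  then show ?thesis by (simp add: kept_def)
next
  case False
  \<comment> \<open>The linking condition does not involve \<open>x\<close>, so the possible
    deleting sets form one fixed countable family.\<close>
  let ?\<W> = "{W. (finite W \<and> W \<subseteq> E) \<and> linked (W \<union> L) e}"
  have "countable {W. finite W \<and> W \<subseteq> E}"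
    using countable_edges by (rule countable_Collect_finite_subset)
  then have cW: "countable ?\<W>" by (rule countable_subset[rotated]) auto
  have m: "(\<lambda>x. l (x f)) \<in> borel_measurable M" if "f \<in> E" for f
    using measurable_compose[OF measurable_label[OF that] l] .
  have "{x \<in> space M. \<forall>f\<in>W. l (x f) < l (x e)} \<in> sets M" if "W \<in> ?\<W>" for W
  proof (rule sets.sets_Collect_finite_All)
    show "{x \<in> space M. l (x f) < l (x e)} \<in> sets M" if "f \<in> W" for f
      using m[of f] m[OF e] that \<open>W \<in> ?\<W>\<close> by (intro borel_measurable_less) auto
  qed (use that in auto)
  then have "(\<Union>W\<in>?\<W>. {x \<in> space M. \<forall>f\<in>W. l (x f) < l (x e)}) \<in> sets M"
    by (intro sets.countable_UN''[OF cW])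
  moreover have "{x \<in> space M. kept l x e} =
      space M - (\<Union>W\<in>?\<W>. {x \<in> space M. \<forall>f\<in>W. l (x f) < l (x e)})"
    using False by (auto simp: kept_def)
  ultimately show ?thesis by simp
qed

text \<open>A translation permutes coordinates, and an injective reindexing preserves a product of
  identical factors.\<close>

lemma distr_translate:
  assumes "\<gamma> \<in> carrier \<Gamma>"
  shows "distr M M (T \<gamma>) = M"
proof -
  have "(\<lambda>e. e #> \<gamma>) \<in> E \<rightarrow> E" using assms shift_in_edges by auto
  from distr_PiM_reindex[OF prob_unit inj_shift[OF assms] this]
  show ?thesis unfolding iid_space_def translate_def by simp
qed

lemma measurable_translate:
  assumes "\<gamma> \<in> carrier \<Gamma>"
  shows "T \<gamma> \<in> M \<rightarrow>\<^sub>M M"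
  unfolding iid_space_def translate_def
  using shift_in_edges[OF _ assms] by (intro measurable_restrict measurable_component_singleton)

text \<open>Two distinct coordinates are distributed as a pair of independent uniform variables, for
  which the diagonal is null by Fubini.\<close>

lemma AE_label_neq:
  assumes ef: "e \<in> E" "f \<in> E" "e \<noteq> f"
  shows "AE x in M. x e \<noteq> x f"
proof -
  let ?U = "restrict_space lborel {0..1::real}"
  interpret U: prob_space ?U by (rule prob_unit)
  interpret UU: pair_sigma_finite ?U ?U ..
  \<comment> \<open>Selecting the coordinates \<open>e\<close> and \<open>f\<close> is a reindexing
    by \<open>bool\<close>, which links \<open>M\<close> to the binary product through the
    \<open>bool\<close>-indexed product \<open>P\<close>.\<close>
  define p where "p = (\<lambda>b. if b then e else f)"
  define P where "P = PiM (UNIV :: bool set) (\<lambda>_. ?U)"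
  have cb: "case_bool ?U ?U = (\<lambda>_. ?U)" by (auto split: bool.split)
  have "inj_on p UNIV" "p \<in> UNIV \<rightarrow> E" using ef by (auto simp: p_def inj_on_def)
  from distr_PiM_reindex[OF prob_unit this]
  have 1: "distr M P (\<lambda>x. \<lambda>b\<in>UNIV. x (p b)) = P" by (simp add: iid_space_def P_def)
  have 2: "?U \<Otimes>\<^sub>M ?U = distr P (?U \<Otimes>\<^sub>M ?U) (\<lambda>x. (x True, x False))"
    using pair_measure_eq_distr_PiM[of ?U ?U] unfolding cb P_def by (simp add: U.sigma_finite_measure_axioms)
  have m1: "(\<lambda>x. \<lambda>b\<in>UNIV. x (p b)) \<in> M \<rightarrow>\<^sub>M P"
    unfolding P_def iid_space_def using ef by (intro measurable_restrict measurable_component_singleton) (auto simp: p_def)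
  have m2: "(\<lambda>x. (x True, x False)) \<in> P \<rightarrow>\<^sub>M ?U \<Otimes>\<^sub>M ?U"
    unfolding P_def by (intro measurable_Pair measurable_component_singleton) auto
  have b: "fst \<in> borel_measurable (?U \<Otimes>\<^sub>M ?U)" "snd \<in> borel_measurable (?U \<Otimes>\<^sub>M ?U)"
    using measurable_fst[of ?U ?U] measurable_snd[of ?U ?U] by (simp_all add: measurable_restrict_space2_iff)
  have s: "{z \<in> space (?U \<Otimes>\<^sub>M ?U). fst z \<noteq> snd z} \<in> sets (?U \<Otimes>\<^sub>M ?U)"
    using b by (rule borel_measurable_neq)
  have "AE v in ?U. u \<noteq> v" for u
    by (subst AE_restrict_space_iff) (auto intro: AE_mp[OF AE_lborel_singleton[of u]])
  then have "AE z in ?U \<Otimes>\<^sub>M ?U. fst z \<noteq> snd z"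
    by (intro UU.AE_pair_measure s) auto
  then have "AE x in P. x True \<noteq> x False"
    by (subst (asm) 2, subst (asm) AE_distr_iff[OF m2 s]) simp
  moreover have "{x \<in> space P. x True \<noteq> x False} \<in> sets P"
    using measurable_sets[OF m2 s] by (rule back_subst[where P = "\<lambda>A. A \<in> sets P"])
      (use measurable_space[OF m2] in auto)
  ultimately have "AE x in M. (\<lambda>b\<in>UNIV. x (p b)) True \<noteq> (\<lambda>b\<in>UNIV. x (p b)) False"
    by (subst (asm) 1[symmetric], subst (asm) AE_distr_iff[OF m1])
  then show ?thesis by (simp add: p_def)
qed

lemma AE_inj_on: "AE x in M. inj_on x E"
proof -
  have "AE x in M. \<forall>e\<in>E. \<forall>f\<in>E. e \<noteq> f \<longrightarrow> x e \<noteq> x f"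
    using AE_label_neq by (simp add: AE_ball_countable countable_edges)
  then show ?thesis by eventually_elim (auto simp: inj_on_def)
qed

lemma translate_space: "\<gamma> \<in> carrier \<Gamma> \<Longrightarrow> x \<in> space M \<Longrightarrow> T \<gamma> x \<in> space M"
  using measurable_translate by (rule measurable_space)

lemma translate_inv:
  assumes "\<gamma> \<in> carrier \<Gamma>" "x \<in> space M"
  shows "T (inv \<gamma>) (T \<gamma> x) = x" "T \<gamma> (T (inv \<gamma>) x) = x"
  using assms by (simp_all add: translate_mult translate_one space_M_extensional)

lemma edge_one: "s \<in> S \<Longrightarrow> {\<one>, s} \<in> E"
  using edgeI[of s \<one>] S_carrier by auto

section \<open>Oriented edges and generation of the orbits\<close>

text \<open>
  Each edge \<open>{g, s g}\<close> is oriented by comparing the labels of \<open>{g, a g}\<close> and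
  \<open>{s g, a s g}\<close>, so that the graphing uses it only once. This also breaks the symmetry of edges
  with \<open>s = s\<inverse>\<close>.
\<close>

definition half :: "(real \<Rightarrow> real) \<Rightarrow> 'g \<Rightarrow> ('g set \<Rightarrow> real) set" where
  "half l s = {x \<in> space M. kept l x {\<one>, s} \<and> x {\<one>, a} < x {s, a \<otimes> s}}"

lemma sets_half:
  assumes "l \<in> borel_measurable borel" "s \<in> S"
  shows "half l s \<in> sets M"
proof -
  have "s \<in> carrier \<Gamma>" using assms S_carrier by auto
  then have "{x \<in> space M. x {\<one>, a} < x {s, a \<otimes> s}} \<in> sets M"
    using edge_one[OF a_S] line_edge_in by (intro borel_measurable_less measurable_label) auto
  moreover have "half l s = {x \<in> space M. kept l x {\<one>, s}} \<inter> {x \<in> space M. x {\<one>, a} < x {s, a \<otimes> s}}"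
    by (auto simp: half_def)
  ultimately show ?thesis using sets_kept[OF assms(1) edge_one[OF assms(2)]] by simp
qed

text \<open>What \<open>T g x\<close> shows at the identity is what \<open>x\<close> shows at
  \<open>g\<close>; thus a set defined at the identity governs the edges at every vertex of the
  orbit.\<close>

lemma translate_in_half_iff:
  assumes g: "g \<in> carrier \<Gamma>" and s: "s \<in> S" and x: "x \<in> space M"
  shows "T g x \<in> half l s \<longleftrightarrow>
    kept l x {g, s \<otimes> g} \<and> x {g, a \<otimes> g} < x {s \<otimes> g, a \<otimes> (s \<otimes> g)}"
proof -
  have sc: "s \<in> carrier \<Gamma>" using s S_carrier by auto
  have "kept l (T g x) {\<one>, s} \<longleftrightarrow> kept l x ({\<one>, s} #> g)"
    using edge_one[OF s] g space_M_extensional[OF x] by (rule kept_translate)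
  moreover have "{\<one>, s} #> g = {g, s \<otimes> g}"
    using shift_edge[of \<one> g s] g sc by simp
  moreover have "T g x {\<one>, a} = x {g, a \<otimes> g}"
    using shift_edge[of \<one> g a] g a_carrier edge_one[OF a_S] by (simp add: translate_apply)
  moreover have "T g x {s, a \<otimes> s} = x {s \<otimes> g, a \<otimes> (s \<otimes> g)}"
    using shift_edge[of s g a] g a_carrier sc line_edge_in[OF sc] by (simp add: translate_apply)
  ultimately show ?thesis using translate_space[OF g x] by (simp add: half_def)
qed

text \<open>Otherwise \<open>a\<close> would square to the identity. Hence distinct vertices have
  distinct line edges, and with injective labels the orientation of an edge is always
  decided.\<close>

lemma line_edge_eq_imp:
  assumes "u \<in> carrier \<Gamma>" "v \<in> carrier \<Gamma>" "{u, a \<otimes> u} = {v, a \<otimes> v}"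
  shows "u = v"
proof (rule ccontr)
  assume "u \<noteq> v"
  with assms(3) have "u = a \<otimes> v" "v = a \<otimes> u" by (auto simp: doubleton_eq_iff)
  then have "u = a \<otimes> (a \<otimes> u)" by simp
  then have "u = (a \<otimes> a) \<otimes> u" using assms a_carrier by (simp add: m_assoc)
  then have "a \<otimes> a = \<one>" using assms a_carrier by (metis m_closed r_cancel_one)
  moreover have "a [^] (2::nat) = a \<otimes> a" using a_carrier by (simp add: numeral_2_eq_2)
  ultimately show False using a_inf[of 2] by simp
qed

text \<open>This is the rounding to multiples of \<open>1/k\<close>, scaled by \<open>k\<close>:
  only the order of the values matters, and integer values allow induction.\<close>

definition level :: "nat \<Rightarrow> real \<Rightarrow> real" where
  "level k t = real_of_int \<lfloor>real k * t\<rfloor>"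

lemma measurable_level: "level k \<in> borel_measurable borel"
  unfolding level_def by measurable

text \<open>The label comparison selects the base point: the edge is used by \<open>s\<close> from
  \<open>u\<close> or by the inverse of \<open>s\<close> from \<open>v\<close>. In the second case
  symmetry of \<open>Q\<close> reverses the pair.\<close>

lemma kept_edge_related:
  assumes x: "x \<in> space M" and inj: "inj_on x E" and Q: "equiv (space M) Q"
    and half: "\<And>s y. s \<in> S \<Longrightarrow> y \<in> half l s \<Longrightarrow> (y, T s y) \<in> Q"
    and uv: "{u, v} \<in> E" "kept l x {u, v}"
  shows "(T u x, T v x) \<in> Q"
proof -
  from uv(1) obtain s where s: "s \<in> S" "u \<in> carrier \<Gamma>" "v = s \<otimes> u" "u \<noteq> v"
    by (rule edge_cases)
  have sc: "s \<in> carrier \<Gamma>" using s S_carrier by auto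
  have vc: "v \<in> carrier \<Gamma>" using s sc by simp
  have u: "u = inv s \<otimes> v" using s sc by (simp add: m_assoc[symmetric])
  have "x {u, a \<otimes> u} \<noteq> x {v, a \<otimes> v}"
    using inj line_edge_in s vc line_edge_eq_imp by (metis inj_onD)
  then consider "x {u, a \<otimes> u} < x {v, a \<otimes> v}" | "x {v, a \<otimes> v} < x {u, a \<otimes> u}" by linarith
  then show ?thesis
  proof cases
    case 1
    then have "T u x \<in> half l s" using translate_in_half_iff[OF s(2,1) x] s uv by simp
    from half[OF s(1) this] show ?thesis using s sc by (simp add: translate_mult)
  next
    case 2
    have "{v, inv s \<otimes> v} = {u, v}" using u by auto
    with 2 have "T v x \<in> half l (inv s)"
      using translate_in_half_iff[OF vc inv_S[OF s(1)] x] u uv by simp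
    from half[OF inv_S[OF s(1)] this] have "(T v x, T u x) \<in> Q"
      using u vc sc by (simp add: translate_mult)
    then show ?thesis using Q by (auto simp: equiv_def dest: symD)
  qed
qed

text \<open>A deleted edge is replaced by a path of line edges, which are kept, and edges of smaller
  level, to which induction applies.\<close>

lemma edge_related:
  assumes x: "x \<in> space M" and inj: "inj_on x E" and Q: "equiv (space M) Q"
    and half: "\<And>s y. s \<in> S \<Longrightarrow> y \<in> half (level k) s \<Longrightarrow> (y, T s y) \<in> Q"
    and e: "e \<in> E" "u \<in> e" "v \<in> e"
  shows "(T u x, T v x) \<in> Q"
  using e
\<comment> \<open>The rounded label is a natural number, so the descent terminates; unrounded labels
  could decrease forever.\<close>
proof (induction "nat \<lfloor>real k * x e\<rfloor>" arbitrary: e u v rule: less_induct)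
  case less
  have kept: "(T p x, T q x) \<in> Q" if "{p, q} \<in> E" "kept (level k) x {p, q}" for p q
    using kept_edge_related[OF x inj Q half that] .
  have refl: "(T p x, T p x) \<in> Q" if "p \<in> carrier \<Gamma>" for p
    using Q translate_space[OF that x] by (auto simp: equiv_def refl_on_def)
  have u: "u \<in> carrier \<Gamma>" using less.prems edge_subset by auto
  show ?case
  proof (cases "u = v")
    case True
    then show ?thesis using refl[OF u] by simp
  next
    case False
    then have e: "e = {u, v}" using less.prems by (auto simp: cayley_edges_def)
    show ?thesis
    proof (cases "kept (level k) x e")
      case True
      then show ?thesis using kept less.prems e by simp
    next
      case False
      then obtain W where W: "W \<subseteq> E" "linked (W \<union> L) e" "\<forall>f\<in>W. level k (x f) < level k (x e)"
        by (auto simp: kept_def)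
      have step: "(T p x, T q x) \<in> Q" if "(p, q) \<in> adj (W \<union> L)" for p q
      proof (cases "{p, q} \<in> L")
        case True
        then show ?thesis using kept[of p q] line_subset by (auto simp: kept_def)
      next
        case False
        then have f: "{p, q} \<in> W" using that by (auto simp: adj_def)
        then have "\<lfloor>real k * x {p, q}\<rfloor> < \<lfloor>real k * x e\<rfloor>" using W(3) by (auto simp: level_def)
        \<comment> \<open>Nonnegative labels ensure that \<open>nat\<close> preserves the strict
          inequality.\<close>
        moreover have "0 \<le> \<lfloor>real k * x {p, q}\<rfloor>"
          using space_M_range[OF x, of "{p, q}"] f W(1) by auto
        ultimately have "nat \<lfloor>real k * x {p, q}\<rfloor> < nat \<lfloor>real k * x e\<rfloor>" by linarith
        from less.hyps[OF this] show ?thesis using f W(1) by blast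
      qed
      have "(u, v) \<in> (adj (W \<union> L))\<^sup>*" using W(2) less.prems by (auto simp: linked_def)
      then show ?thesis
      proof (induction rule: rtrancl_induct)
        case base
        show ?case using refl[OF u] .
      next
        case (step y z)
        with \<open>\<And>q p. (p, q) \<in> adj (W \<union> L) \<Longrightarrow> (T p x, T q x) \<in> Q\<close>
        have "(T y x, T z x) \<in> Q" by blast
        with step.IH show ?case using Q unfolding equiv_def by (blast dest: transD)
      qed
    qed
  qed
qed

lemma orbit_related:
  assumes x: "x \<in> space M" and inj: "inj_on x E" and Q: "equiv (space M) Q"
    and half: "\<And>s y. s \<in> S \<Longrightarrow> y \<in> half (level k) s \<Longrightarrow> (y, T s y) \<in> Q"
    and \<gamma>: "\<gamma> \<in> carrier \<Gamma>"
  shows "(x, T \<gamma> x) \<in> Q"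
proof -
  have edge: "(T g x, T (s \<otimes> g) x) \<in> Q" if "s \<in> S" "g \<in> carrier \<Gamma>" for s g
    using edge_related[OF x inj Q half edgeI[OF that]] by auto
  have "\<gamma> \<in> generate \<Gamma> S" using \<gamma> gen by simp
  \<comment> \<open>Allowing every starting point \<open>g\<close> lets the product case chain the
    two relations.\<close>
  then have "\<forall>g\<in>carrier \<Gamma>. (T g x, T (\<gamma> \<otimes> g) x) \<in> Q"
  proof (induction \<gamma> rule: generate.induct)
    case one
    then show ?case using Q translate_space[OF _ x] by (auto simp: equiv_def refl_on_def)
  next
    case (incl h)
    then show ?case using edge by blast
  next
    case (inv h)
    then show ?case using edge inv_S by blast
  next
    case (eng h1 h2)
    have "h1 \<in> carrier \<Gamma>" "h2 \<in> carrier \<Gamma>" using eng gen by auto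
    show ?case
    proof
      fix g assume g: "g \<in> carrier \<Gamma>"
      then have "(T g x, T (h2 \<otimes> g) x) \<in> Q" "(T (h2 \<otimes> g) x, T (h1 \<otimes> (h2 \<otimes> g)) x) \<in> Q"
        using eng \<open>h2 \<in> carrier \<Gamma>\<close> by auto
      then have "(T g x, T (h1 \<otimes> (h2 \<otimes> g)) x) \<in> Q" using Q unfolding equiv_def by (blast dest: transD)
      then show "(T g x, T (h1 \<otimes> h2 \<otimes> g) x) \<in> Q"
        using \<open>h1 \<in> carrier \<Gamma>\<close> \<open>h2 \<in> carrier \<Gamma>\<close> g by (simp add: m_assoc)
    qed
  qed
  then have "(T \<one> x, T (\<gamma> \<otimes> \<one>) x) \<in> Q" by blast
  then show ?thesis using \<gamma> x by (simp add: translate_one space_M_extensional)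
qed

section \<open>The graphing by restricted translations and its cost\<close>

lemma borel_isomorphism_translate:
  assumes s: "s \<in> carrier \<Gamma>" and A: "A \<in> sets M"
  shows "borel_isomorphism M A (T s ` A) (T s)"
proof -
  have AM: "A \<subseteq> space M" using A by (rule sets.sets_into_space)
  have inj: "inj_on (T s) A"
    using translate_inv(1)[OF s] AM by (intro inj_on_inverseI[where g = "T (inv s)"]) auto
  \<comment> \<open>Writing the image as a preimage under the inverse translation makes it
    measurable.\<close>
  have image: "T s ` A = T (inv s) -` A \<inter> space M"
  proof (intro equalityI subsetI)
    fix z assume "z \<in> T s ` A"
    then show "z \<in> T (inv s) -` A \<inter> space M"
      using translate_inv(1)[OF s] translate_space[OF s] AM by (auto simp: subset_iff)
  next
    fix z assume "z \<in> T (inv s) -` A \<inter> space M"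
    then show "z \<in> T s ` A"
      using translate_inv(2)[OF s] by (intro image_eqI[of _ _ "T (inv s) z"]) auto
  qed
  have B: "T s ` A \<in> sets M"
    unfolding image using measurable_translate[OF inv_closed[OF s]] A by (rule measurable_sets)
  have inv_eq: "the_inv_into A (T s) y = T (inv s) y" if "y \<in> T s ` A" for y
    using that the_inv_into_f_f[OF inj] translate_inv(1)[OF s] AM by auto
  have "T (inv s) \<in> restrict_space M (T s ` A) \<rightarrow>\<^sub>M restrict_space M A"
    using measurable_translate[OF inv_closed[OF s]]
    by (rule measurable_restrict_space3) (auto simp: image)
  then have "the_inv_into A (T s) \<in> restrict_space M (T s ` A) \<rightarrow>\<^sub>M restrict_space M A"
    by (subst measurable_cong[where g = "T (inv s)"]) (auto simp: space_restrict_space inv_eq)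
  moreover have "T s \<in> restrict_space M A \<rightarrow>\<^sub>M restrict_space M (T s ` A)"
    using measurable_translate[OF s] by (rule measurable_restrict_space3) auto
  ultimately show ?thesis
    using A B inj by (auto simp: borel_isomorphism_def bij_betw_def)
qed

lemma equiv_orbit_relation: "equiv (space M) (orbit_relation \<Gamma> M T)"
proof (rule equivI)
  show "orbit_relation \<Gamma> M T \<subseteq> space M \<times> space M"
    using translate_space by (auto simp: orbit_relation_def)
  show "refl_on (space M) (orbit_relation \<Gamma> M T)"
  proof (rule refl_onI)
    fix x assume "x \<in> space M"
    then have "x = T \<one> x" by (simp add: translate_one space_M_extensional)
    with \<open>x \<in> space M\<close> show "(x, x) \<in> orbit_relation \<Gamma> M T"
      unfolding orbit_relation_def by blast
  qed
  show "sym (orbit_relation \<Gamma> M T)"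
  proof (rule symI)
    fix x y assume "(x, y) \<in> orbit_relation \<Gamma> M T"
    then obtain \<gamma> where \<gamma>: "\<gamma> \<in> carrier \<Gamma>" "x \<in> space M" "y = T \<gamma> x"
      by (auto simp: orbit_relation_def)
    then have "x = T (inv \<gamma>) y" "y \<in> space M" by (auto simp: translate_inv translate_space)
    with \<gamma> show "(y, x) \<in> orbit_relation \<Gamma> M T" unfolding orbit_relation_def by blast
  qed
  show "trans (orbit_relation \<Gamma> M T)"
  proof (rule transI)
    fix x y z assume "(x, y) \<in> orbit_relation \<Gamma> M T" "(y, z) \<in> orbit_relation \<Gamma> M T"
    then obtain g h where "g \<in> carrier \<Gamma>" "h \<in> carrier \<Gamma>" "x \<in> space M" "y = T g x" "z = T h y"
      by (auto simp: orbit_relation_def)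
    then have "z = T (h \<otimes> g) x" "h \<otimes> g \<in> carrier \<Gamma>" "x \<in> space M" by (auto simp: translate_mult)
    then show "(x, z) \<in> orbit_relation \<Gamma> M T" unfolding orbit_relation_def by blast
  qed
qed

lemma action_cost_le: "action_cost \<Gamma> M T \<le> (\<Sum>s\<in>S. emeasure M (half (level k) s))"
proof -
  let ?A = "half (level k)" and ?R = "orbit_relation \<Gamma> M T"
  obtain h where h: "bij_betw h {0..<card S} S"
    using ex_bij_betw_nat_finite[OF fin_S] by blast
  define I where "I = {0..<card S}"
  have hS: "h i \<in> S" if "i \<in> I" for i
    using h that unfolding I_def by (rule bij_betw_apply)
  define P where "P = {(y, T (h i) y) | i y. i \<in> I \<and> y \<in> ?A (h i)}"
  have P_R: "P \<subseteq> ?R"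
    using hS S_carrier by (force simp: P_def orbit_relation_def half_def)
  have "?R `` {x} = generated_equiv (space M) P `` {x}"
    if x: "x \<in> space M" and inj: "inj_on x E" for x
  proof
    have "generated_equiv (space M) P \<subseteq> ?R"
      using P_R equiv_orbit_relation by (auto simp: generated_equiv_def)
    then show "generated_equiv (space M) P `` {x} \<subseteq> ?R `` {x}" by auto
    \<comment> \<open>The generated relation is an intersection, so membership is checked in each
      equivalence relation \<open>Q\<close> containing \<open>P\<close>.\<close>
    have "(x, T \<gamma> x) \<in> Q" if \<gamma>: "\<gamma> \<in> carrier \<Gamma>" and Q: "equiv (space M) Q" "P \<subseteq> Q" for \<gamma> Q
    proof (rule orbit_related[OF x inj Q(1) _ \<gamma>])
      fix s y assume "s \<in> S" "y \<in> ?A s"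
      moreover from this obtain i where "i \<in> I" "s = h i"
        using h unfolding I_def bij_betw_def by blast
      ultimately have "(y, T s y) \<in> P" by (auto simp: P_def)
      then show "(y, T s y) \<in> Q" using Q by auto
    qed
    then show "?R `` {x} \<subseteq> generated_equiv (space M) P `` {x}"
      by (auto simp: generated_equiv_def orbit_relation_def)
  qed
  note R_eq = this
  have "AE x in M. ?R `` {x} = generated_equiv (space M) P `` {x}"
    using AE_inj_on AE_space by eventually_elim (rule R_eq)
  moreover have "borel_isomorphism M (?A (h i)) (T (h i) ` ?A (h i)) (T (h i))" if "i \<in> I" for i
    using hS[OF that] S_carrier
    by (intro borel_isomorphism_translate sets_half measurable_level) auto
  moreover have "AE x in M. x \<in> ?A (h i) \<longrightarrow> (x, T (h i) x) \<in> ?R" if "i \<in> I" for i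
    using P_R that by (intro AE_I2) (auto simp: P_def)
  ultimately have "graphing M ?R I (\<lambda>i. ?A (h i)) (\<lambda>i. T (h i) ` ?A (h i)) (\<lambda>i. T (h i))"
    unfolding graphing_def P_def by blast
  then have "cost M ?R \<le> (\<Sum>\<^sub>\<infinity>i\<in>I. emeasure M (?A (h i)))"
    unfolding cost_def by (intro Inf_lower CollectI exI conjI) (rule refl)
  also have "\<dots> = (\<Sum>i\<in>I. emeasure M (?A (h i)))" by (simp add: I_def)
  also have "\<dots> = (\<Sum>s\<in>S. emeasure M (?A s))"
    using h unfolding I_def by (rule sum.reindex_bij_betw)
  finally show ?thesis by (simp add: action_cost_def)
qed

section \<open>Comparison of the cost with the expected degree\<close>

text \<open>Invariance allows the set for the inverse of \<open>s\<close> to be pulled back by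
  \<open>T s\<close>. It then concerns the same edge from the identity to \<open>s\<close>, but with
  the opposite label comparison, so the two events are disjoint.\<close>

lemma emeasure_half_add_le:
  assumes l: "l \<in> borel_measurable borel" and s: "s \<in> S"
  shows "emeasure M (half l s) + emeasure M (half l (inv s)) \<le>
    emeasure M {x \<in> space M. kept l x {\<one>, s}}"
proof -
  have sc: "s \<in> carrier \<Gamma>" using s S_carrier by auto
  let ?B = "T s -` half l (inv s) \<inter> space M"
  have B: "?B \<in> sets M"
    using measurable_translate[OF sc] sets_half[OF l inv_S[OF s]] by (rule measurable_sets)
  have "emeasure M (half l (inv s)) = emeasure (distr M M (T s)) (half l (inv s))"
    using sc by (simp add: distr_translate)
  also have "\<dots> = emeasure M ?B"
    using measurable_translate[OF sc] sets_half[OF l inv_S[OF s]] by (rule emeasure_distr)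
  finally have B_eq: "emeasure M (half l (inv s)) = emeasure M ?B" .
  have B_iff: "kept l x {\<one>, s} \<and> x {s, a \<otimes> s} < x {\<one>, a}" if "x \<in> ?B" for x
  proof -
    have "T s x \<in> half l (inv s)" "x \<in> space M" using that by auto
    then show ?thesis
      using translate_in_half_iff[OF sc inv_S[OF s], of x l] sc a_carrier by (simp add: insert_commute)
  qed
  have "half l s \<inter> ?B = {}"
  proof (rule equals0I)
    fix x assume x: "x \<in> half l s \<inter> ?B"
    then have "x {\<one>, a} < x {s, a \<otimes> s}" by (simp add: half_def)
    with B_iff[of x] x show False by auto
  qed
  then have "emeasure M (half l s) + emeasure M ?B = emeasure M (half l s \<union> ?B)"
    using plus_emeasure[OF sets_half[OF l s] B] by simp
  also have "\<dots> \<le> emeasure M {x \<in> space M. kept l x {\<one>, s}}"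
    using B_iff by (intro emeasure_mono sets_kept[OF l edge_one[OF s]]) (auto simp: half_def)
  finally show ?thesis unfolding B_eq .
qed

text \<open>Inversion permutes \<open>S\<close>, so summing the previous bound over \<open>S\<close>
  counts each term of the cost bound twice.\<close>

lemma two_action_cost_le:
  "2 * action_cost \<Gamma> M T \<le> (\<Sum>s\<in>S. emeasure M {x \<in> space M. kept (level k) x {\<one>, s}})"
proof -
  let ?m = "\<lambda>s. emeasure M (half (level k) s)"
  have "bij_betw (m_inv \<Gamma>) S S"
    using S_sym inj_on_subset[OF inv_inj S_carrier] by (auto simp: bij_betw_def)
  then have inv: "(\<Sum>s\<in>S. ?m (inv s)) = (\<Sum>s\<in>S. ?m s)" by (rule sum.reindex_bij_betw)
  have "2 * action_cost \<Gamma> M T \<le> 2 * (\<Sum>s\<in>S. ?m s)"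
    by (intro mult_left_mono action_cost_le) auto
  also have "\<dots> = (\<Sum>s\<in>S. ?m s + ?m (inv s))"
    by (simp add: sum.distrib inv mult_2)
  also have "\<dots> \<le> (\<Sum>s\<in>S. emeasure M {x \<in> space M. kept (level k) x {\<one>, s}})"
    by (intro sum_mono emeasure_half_add_le measurable_level)
  finally show ?thesis .
qed

text \<open>A strict inequality between levels implies one between labels, so rounding never deletes
  more. Conversely, a deleting set is finite, and its finitely many positive label gaps are all
  detected once \<open>k\<close> is large.\<close>

lemma eventually_kept_level_iff: "\<forall>\<^sub>F k in sequentially. kept (level k) x e \<longleftrightarrow> kept id x e"
proof (cases "kept id x e")
  case True
  have "x f < x e" if "level k (x f) < level k (x e)" for k f
  proof (rule ccontr)
    assume "\<not> x f < x e"
    then have "\<lfloor>real k * x e\<rfloor> \<le> \<lfloor>real k * x f\<rfloor>" by (intro floor_mono mult_left_mono) auto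
    with that show False by (simp add: level_def)
  qed
  with True have "kept (level k) x e" for k unfolding kept_def id_def by blast
  then show ?thesis using True by simp
next
  case False
  then obtain W where W: "finite W" "W \<subseteq> E" "linked (W \<union> L) e" "\<forall>f\<in>W. x f < x e" and "e \<notin> L"
    by (auto simp: kept_def)
  have "\<forall>\<^sub>F k in sequentially. level k (x f) < level k (x e)" if "f \<in> W" for f
  proof -
    have pos: "0 < x e - x f" using W(4) that by auto
    \<comment> \<open>Once \<open>k\<close> times the gap is at least 1, the two floors
      differ.\<close>
    have "\<forall>\<^sub>F k in sequentially. 1 / (x e - x f) \<le> real k"
      using eventually_ge_at_top[of "nat \<lceil>1 / (x e - x f)\<rceil>"] by eventually_elim linarith
    then show ?thesis
    proof eventually_elim
      case (elim k)
      then have "1 \<le> real k * x e - real k * x f" using pos by (simp add: field_simps)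
      then have "\<lfloor>real k * x f\<rfloor> < \<lfloor>real k * x e\<rfloor>" by linarith
      then show ?case by (simp add: level_def)
    qed
  qed
  then have "\<forall>\<^sub>F k in sequentially. \<forall>f\<in>W. level k (x f) < level k (x e)"
    using W(1) by (simp add: eventually_ball_finite)
  then show ?thesis
  proof eventually_elim
    case (elim k)
    then have "\<not> kept (level k) x e" using W \<open>e \<notin> L\<close> by (auto simp: kept_def)
    with False show ?case by simp
  qed
qed

lemma tendsto_emeasure_kept:
  assumes e: "e \<in> E"
  shows "(\<lambda>k. emeasure M {x \<in> space M. kept (level k) x e}) \<longlonglongrightarrow> emeasure M {x \<in> space M. kept id x e}"
proof -
  interpret prob_space M by (rule prob_M)
  let ?K = "\<lambda>l. {x \<in> space M. kept l x e}"
  have K: "?K (level k) \<in> sets M" "?K id \<in> sets M" for k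
    using sets_kept[OF measurable_level e] sets_kept[of id, OF _ e] by (auto simp: id_def)
  have lim: "(\<lambda>k. \<integral>x. indicator (?K (level k)) x \<partial>M) \<longlonglongrightarrow> (\<integral>x. (indicator (?K id) x :: real) \<partial>M)"
  proof (rule integral_dominated_convergence[where w = "\<lambda>_. 1"])
    show "AE x in M. (\<lambda>k. indicator (?K (level k)) x) \<longlonglongrightarrow> (indicator (?K id) x :: real)"
    proof (rule AE_I2)
      fix x
      show "(\<lambda>k. indicator (?K (level k)) x) \<longlonglongrightarrow> (indicator (?K id) x :: real)"
        by (rule tendsto_eventually, rule eventually_mono[OF eventually_kept_level_iff[of x e]])
          (auto simp: indicator_def)
    qed
  qed (use K in \<open>auto simp: indicator_def\<close>)
  then have "(\<lambda>k. measure M (?K (level k))) \<longlonglongrightarrow> measure M (?K id)"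
    using K by simp
  then show ?thesis by (simp add: emeasure_eq_measure)
qed

text \<open>The left side does not depend on \<open>k\<close>, so the inequality for the rounded
  graphs passes to the limit. No connectedness of the forest itself is claimed.\<close>

lemma two_action_cost_le_kept:
  "2 * action_cost \<Gamma> M T \<le> (\<Sum>s\<in>S. emeasure M {x \<in> space M. kept id x {\<one>, s}})"
proof (rule LIMSEQ_le_const)
  show "(\<lambda>k. \<Sum>s\<in>S. emeasure M {x \<in> space M. kept (level k) x {\<one>, s}}) \<longlonglongrightarrow>
      (\<Sum>s\<in>S. emeasure M {x \<in> space M. kept id x {\<one>, s}})"
    by (intro tendsto_sum tendsto_emeasure_kept edge_one)
qed (use two_action_cost_le in blast)

section \<open>The forest as a factor of i.i.d. and its degree\<close>

definition forest_map :: "('g set \<Rightarrow> real) \<Rightarrow> 'g set \<Rightarrow> bool" where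
  "forest_map x = (\<lambda>e\<in>E. kept id x e)"

lemma subgraph_forest_map: "subgraph_edges \<Gamma> S (forest_map x) = {e \<in> E. kept id x e}"
  by (auto simp: subgraph_edges_def forest_map_def)

lemma measurable_forest_map: "forest_map \<in> M \<rightarrow>\<^sub>M config_space \<Gamma> S"
  unfolding config_space_def forest_map_def
  using sets_kept[of id] by (intro measurable_restrict) (auto simp: pred_def id_def)

lemma forest_map_translate:
  assumes "\<gamma> \<in> carrier \<Gamma>" "x \<in> space M"
  shows "forest_map (T \<gamma> x) = translate \<Gamma> S \<gamma> (forest_map x)"
  using assms kept_translate[OF _ _ space_M_extensional]
  by (auto simp: forest_map_def translate_def[of \<Gamma> S \<gamma> "restrict _ _"] fun_eq_iff shift_in_edges)

abbreviation "\<sigma> \<equiv> distr M (config_space \<Gamma> S) forest_map"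

lemma measurable_config_edge:
  "e \<in> E \<Longrightarrow> (\<lambda>x. x e) \<in> config_space \<Gamma> S \<rightarrow>\<^sub>M count_space UNIV"
  unfolding config_space_def by (rule measurable_component_singleton)

lemma edges_at_one: "{e \<in> E. \<one> \<in> e} = (\<lambda>s. {\<one>, s}) ` S"
proof
  show "{e \<in> E. \<one> \<in> e} \<subseteq> (\<lambda>s. {\<one>, s}) ` S"
  proof
    fix e assume "e \<in> {e \<in> E. \<one> \<in> e}"
    then obtain g s where "e \<in> E" "e = {g, s \<otimes> g}" "\<one> = g \<or> \<one> = s \<otimes> g"
      by (auto simp: cayley_edges_def)
    then obtain v where "e = {\<one>, v}" "{\<one>, v} \<in> E" by (metis insert_commute)
    then show "e \<in> (\<lambda>s. {\<one>, s}) ` S"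
      using S_carrier by (elim edge_cases) auto
  qed
qed (use edge_one in auto)

text \<open>Edges at the identity correspond to their other endpoint \<open>s\<close>; an involution
  \<open>s\<close> thus contributes a single edge.\<close>

lemma degree_eq: "card {e \<in> subgraph_edges \<Gamma> S x. \<one> \<in> e} = (\<Sum>s\<in>S. if x {\<one>, s} then 1 else 0)"
proof -
  have "{e \<in> subgraph_edges \<Gamma> S x. \<one> \<in> e} = (\<lambda>s. {\<one>, s}) ` {s \<in> S. x {\<one>, s}}"
  proof -
    have "{e \<in> subgraph_edges \<Gamma> S x. \<one> \<in> e} = {e \<in> {e \<in> E. \<one> \<in> e}. x e}"
      by (auto simp: subgraph_edges_def)
    then show ?thesis unfolding edges_at_one by auto
  qed
  moreover have "inj_on (\<lambda>s. {\<one>, s}) {s \<in> S. x {\<one>, s}}"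
    by (auto simp: inj_on_def doubleton_eq_iff)
  ultimately show ?thesis using fin_S by (simp add: card_image sum.If_cases Int_def conj_commute)
qed

lemma expected_degree_eq:
  "expected_degree \<Gamma> S \<sigma> = (\<Sum>s\<in>S. emeasure M {x \<in> space M. kept id x {\<one>, s}})"
proof -
  have m: "Measurable.pred (config_space \<Gamma> S) (\<lambda>x. x {\<one>, s})" if "s \<in> S" for s
    using edge_one[OF that] by (rule measurable_config_edge)
  have "expected_degree \<Gamma> S \<sigma> = (\<integral>\<^sup>+x. (\<Sum>s\<in>S. if x {\<one>, s} then 1 else 0) \<partial>\<sigma>)"
    unfolding expected_degree_def degree_eq by (intro nn_integral_cong) (auto simp: of_nat_sum intro!: sum.cong)
  also have "\<dots> = (\<integral>\<^sup>+x. (\<Sum>s\<in>S. if forest_map x {\<one>, s} then 1 else 0) \<partial>M)"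
    using m by (intro nn_integral_distr measurable_forest_map borel_measurable_sum measurable_If) auto
  also have "\<dots> = (\<integral>\<^sup>+x. (\<Sum>s\<in>S. indicator {x \<in> space M. kept id x {\<one>, s}} x) \<partial>M)"
    using edge_one by (intro nn_integral_cong sum.cong) (auto simp: forest_map_def indicator_def)
  also have "\<dots> = (\<Sum>s\<in>S. \<integral>\<^sup>+x. indicator {x \<in> space M. kept id x {\<one>, s}} x \<partial>M)"
    using sets_kept[of id] edge_one
    by (intro nn_integral_sum borel_measurable_indicator) (auto simp: id_def)
  also have "\<dots> = (\<Sum>s\<in>S. emeasure M {x \<in> space M. kept id x {\<one>, s}})"
    using sets_kept[of id] edge_one
    by (intro sum.cong nn_integral_indicator) (auto simp: id_def)
  finally show ?thesis .
qed

lemma sets_config_edge: "e \<in> E \<Longrightarrow> {y \<in> space (config_space \<Gamma> S). y e} \<in> sets (config_space \<Gamma> S)"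
  using measurable_config_edge unfolding pred_def .

text \<open>The complement is a countable union, over finite edge sets containing a cycle, of the
  events that all their edges are present. Measurability lets the almost sure statement pass to the
  image measure.\<close>

lemma sets_config_forest:
  "{y \<in> space (config_space \<Gamma> S). forest (subgraph_edges \<Gamma> S y)} \<in> sets (config_space \<Gamma> S)"
proof -
  let ?N = "config_space \<Gamma> S" and ?\<C> = "{C. (finite C \<and> C \<subseteq> E) \<and> \<not> forest C}"
  have "countable {C. finite C \<and> C \<subseteq> E}"
    using countable_edges by (rule countable_Collect_finite_subset)
  then have cC: "countable ?\<C>" by (rule countable_subset[rotated]) auto
  have "{y \<in> space ?N. \<forall>e\<in>C. y e} \<in> sets ?N" if "C \<in> ?\<C>" for C
    using that by (intro sets.sets_Collect_finite_All sets_config_edge) auto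
  then have "(\<Union>C\<in>?\<C>. {y \<in> space ?N. \<forall>e\<in>C. y e}) \<in> sets ?N"
    by (intro sets.countable_UN''[OF cC])
  moreover have "{y \<in> space ?N. forest (subgraph_edges \<Gamma> S y)} =
      space ?N - (\<Union>C\<in>?\<C>. {y \<in> space ?N. \<forall>e\<in>C. y e})"
  proof -
    have "forest (subgraph_edges \<Gamma> S y) \<longleftrightarrow> \<not> (\<exists>C\<in>?\<C>. \<forall>e\<in>C. y e)" for y
      by (subst forest_iff_finite) (auto simp: subgraph_edges_def subset_iff)
    then show ?thesis by auto
  qed
  ultimately show ?thesis by simp
qed

lemma random_spanning_forest_sigma: "random_spanning_forest \<Gamma> S \<sigma>"
proof -
  have "AE x in M. forest (subgraph_edges \<Gamma> S (forest_map x))"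
    using AE_inj_on unfolding subgraph_forest_map by eventually_elim (rule kept_forest)
  then have "AE y in \<sigma>. forest (subgraph_edges \<Gamma> S y)"
    by (subst AE_distr_iff[OF measurable_forest_map sets_config_forest])
  then show ?thesis
    using prob_space.prob_space_distr[OF prob_M measurable_forest_map]
    by (simp add: random_spanning_forest_def)
qed

text \<open>Each line edge is kept for every labelling; countability of \<open>L\<close> combines
  the separate almost sure statements.\<close>

lemma AE_line_subset_sigma: "AE y in \<sigma>. L \<subseteq> subgraph_edges \<Gamma> S y"
proof -
  have "AE y in \<sigma>. y e" if "e \<in> L" for e
    using that line_subset
    by (subst AE_distr_iff[OF measurable_forest_map sets_config_edge])
      (auto simp: forest_map_def kept_def)
  then have "AE y in \<sigma>. \<forall>e\<in>L. y e"
    using countable_subset[OF line_subset countable_edges] by (simp add: AE_ball_countable)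
  then show ?thesis by eventually_elim (use line_subset in \<open>auto simp: subgraph_edges_def\<close>)
qed

lemma factor_of_iid_sigma: "factor_of_iid \<Gamma> S \<sigma>"
  unfolding factor_of_iid_def using measurable_forest_map forest_map_translate by blast

end

theorem theorem3:
  fixes \<Gamma> :: "('g, 'm) monoid_scheme" and S :: "'g set" and a :: 'g
  assumes "group \<Gamma>"
    and "S \<subseteq> carrier \<Gamma>" and "finite S"
    and "m_inv \<Gamma> ` S = S" and "\<one>\<^bsub>\<Gamma>\<^esub> \<notin> S"
    and "generate \<Gamma> S = carrier \<Gamma>"
    and "a \<in> S"
    and "\<forall>n::nat. n > 0 \<longrightarrow> a [^]\<^bsub>\<Gamma>\<^esub> n \<noteq> \<one>\<^bsub>\<Gamma>\<^esub>"
  shows "\<exists>\<sigma>. random_spanning_forest \<Gamma> S \<sigma> \<and>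
    (AE x in \<sigma>. line_edges \<Gamma> a \<subseteq> subgraph_edges \<Gamma> S x) \<and>
    factor_of_iid \<Gamma> S \<sigma> \<and>
    expected_degree \<Gamma> S \<sigma> \<ge> 2 * action_cost \<Gamma> (iid_space \<Gamma> S) (translate \<Gamma> S)"
proof -
  interpret group \<Gamma> by fact
  interpret cayley_line \<Gamma> S a
    by unfold_locales (use assms in auto)
  show ?thesis
    using random_spanning_forest_sigma AE_line_subset_sigma factor_of_iid_sigma
      two_action_cost_le_kept expected_degree_eq by (intro exI[of _ \<sigma>]) auto
qed

end
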